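(* The polynomials $A_d^{(0)}(t)$ and $A_d^{(\neq 0)}(t):=\sum_{s=1}^{r-1}A_d^{(s)}(t)$ are symmetric of degree $d-1$, so these can be expressed as: $$A_d^{(0)}(t)=\sum_{i=0}^{\lfloor\frac{d-1}{2}\rfloor}a^{(0)}(d,i,i)t^i(1+t)^{d-1-2i}$$ and $$A_d^{(\neq 0)}(t)=\sum_{i=0}^{\lfloor\frac{d-1}{2}\rfloor}a^{(\neq 0)}(d,i,i)t^{i}(1+t)^{d-2i},$$ where $a^{(0)}(d,i,i)$ is the number of $r$-colored permutations $\sigma \in A_d^{(0)}$ with $i$ descents and $i+1$ slides; and $a^{(\neq 0)}(d,i,i)$ is the number of $r$-colored permutations $\sigma \in A_d^{(\neq 0)}$ with $i$ descents and $i+1$ slides. In particular, the polynomials $A_d^{(0)}(t)$ and $A_d^{(\neq 0)}(t)$ are $\gamma$-nonnegative.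
   Context: Fix integers $d\geq 1$, $r\geq 1$. The $r$-colored permutation group $\mathbb{Z}_r\wr\Omega_d$ consists of bijections $\sigma$ of $\{1^{(0)},\ldots,d^{(0)},\ldots,1^{(r-1)},\ldots,d^{(r-1)}\}$ with $\sigma(i^{(s)})=j^{(t)}\Rightarrow \sigma(i^{(s+1)})=j^{(t+1)}$ (exponents mod $r$); write $\sigma=(\sigma_1^{\epsilon_1},\ldots,\sigma_d^{\epsilon_d})$, $\epsilon_i$ the color of $\sigma_i$. The descent set is $\mathrm{Des}(\sigma)=\{1\leq i\leq d : \epsilon_i>\epsilon_{i+1}$, or $\epsilon_i=\epsilon_{i+1}$ and $\sigma_i>\sigma_{i+1}\}$ with $\sigma_{d+1}:=d+1$, $\epsilon_{d+1}:=0$, and $\mathrm{des}(\sigma)=|\mathrm{Des}(\sigma)|$. Let $A_d=\{\sigma : \epsilon_1=0\}$, $A_d^{(s)}=\{\sigma\in A_d : \epsilon_d=s\}$, $A_d^{(\neq 0)}=\{\sigma\in A_d:\epsilon_d\neq 0\}$, and $A_d^{(s)}(t)=\sum_{\sigma\in A_d^{(s)}}t^{\mathrm{des}(\sigma)}$. Slides: for $\sigma$, consider $\sigma_0^{\epsilon_0}\sigma_1^{\epsilon_1}\cdots\sigma_d^{\epsilon_d}\sigma_{d+1}^{\epsilon_{d+1}}$ with $\sigma_0=\infty,\epsilon_0=0,\sigma_{d+1}=d+1,\epsilon_{d+1}=0$; put asterisks at both ends and between consecutive entries whenever $\sigma_i^{\epsilon_i}<\sigma_{i+1}^{\epsilon_{i+1}}$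 (i.e. $\epsilon_i<\epsilon_{i+1}$, or $\epsilon_i=\epsilon_{i+1}$ and $\sigma_i<\sigma_{i+1}$). A slide is any segment between asterisks of length at least 2 (a decreasing run of length $\geq 2$). A symmetric polynomial $p$ of degree $n$ is written uniquely as $\sum_i\gamma_i x^i(1+x)^{n-2i}$; it is $\gamma$-nonnegative if all $\gamma_i\geq 0$.
   Formalization: The second sum runs to ⌊d/2⌋ (the printed ⌊(d−1)/2⌋ fails for d=r=2, where A^{(≠0)}=2t); A^{(≠0)} is symmetric and γ-nonnegative with respect to d, not d−1, and its degree d−1 is claimed only for d,r≥2, since otherwise it is 0. *)

theory Defs
  imports
    "HOL-Computational_Algebra.Polynomial"
    "HOL-Combinatorics.Permutations"
    "HOL-Library.Extended_Nat"
begin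

text \<open>The coloured letter \<open>i\<^sup>(\<^sup>s\<^sup>)\<close> is the pair \<open>(i, s)\<close>. A colored permutation is a bijection
  of the finite set of coloured letters; by the convention of \<open>permutes\<close> it is the identity on all
  other pairs, so that each such bijection is represented exactly once.\<close>

definition colored_perms :: "nat \<Rightarrow> nat \<Rightarrow> (nat \<times> nat \<Rightarrow> nat \<times> nat) set" where
  "colored_perms d r = {\<sigma>. \<sigma> permutes ({1..d} \<times> {0..<r}) \<and>
     (\<forall>i\<in>{1..d}. \<forall>s\<in>{0..<r}. \<forall>j t. \<sigma> (i, s) = (j, t) \<longrightarrow>
        \<sigma> (i, (s + 1) mod r) = (j, (t + 1) mod r))}"

text \<open>Window notation: \<open>\<sigma> (i\<^sup>(\<^sup>0\<^sup>)) = \<sigma>\<^sub>i\<close> with colour \<open>\<epsilon>\<^sub>i\<close>, extended to the positions \<open>0\<close>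
  and \<open>d + 1\<close>. The values are of type \<^typ>\<open>enat\<close> only because of \<open>\<sigma>\<^sub>0 = \<infinity>\<close>.\<close>

definition win_val :: "nat \<Rightarrow> (nat \<times> nat \<Rightarrow> nat \<times> nat) \<Rightarrow> nat \<Rightarrow> enat" where
  "win_val d \<sigma> i =
     (if i = 0 then \<infinity> else if i = d + 1 then enat (d + 1) else enat (fst (\<sigma> (i, 0))))"

definition win_col :: "nat \<Rightarrow> (nat \<times> nat \<Rightarrow> nat \<times> nat) \<Rightarrow> nat \<Rightarrow> nat" where
  "win_col d \<sigma> i = (if i = 0 \<or> i = d + 1 then 0 else snd (\<sigma> (i, 0)))"

definition Des :: "nat \<Rightarrow> (nat \<times> nat \<Rightarrow> nat \<times> nat) \<Rightarrow> nat set" where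
  "Des d \<sigma> = {i \<in> {1..d}. win_col d \<sigma> i > win_col d \<sigma> (i + 1) \<or>
     (win_col d \<sigma> i = win_col d \<sigma> (i + 1) \<and> win_val d \<sigma> i > win_val d \<sigma> (i + 1))}"

definition des :: "nat \<Rightarrow> (nat \<times> nat \<Rightarrow> nat \<times> nat) \<Rightarrow> nat" where
  "des d \<sigma> = card (Des d \<sigma>)"

text \<open>The word has the \<open>d + 2\<close> entries \<open>0, \<dots>, d + 1\<close>; the gap in front of entry \<open>k\<close> is numbered \<open>k\<close>
  and the gap at the right end \<open>d + 2\<close>. A slide, enclosed by the consecutive asterisks \<open>a < b\<close>,
  consists of the entries \<open>a, \<dots>, b - 1\<close>.\<close>

definition asterisks :: "nat \<Rightarrow> (nat \<times> nat \<Rightarrow> nat \<times> nat) \<Rightarrow> nat set" where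
  "asterisks d \<sigma> = {0, d + 2} \<union> {i + 1 | i. i \<le> d \<and>
     (win_col d \<sigma> i < win_col d \<sigma> (i + 1) \<or>
      (win_col d \<sigma> i = win_col d \<sigma> (i + 1) \<and> win_val d \<sigma> i < win_val d \<sigma> (i + 1)))}"

definition slides :: "nat \<Rightarrow> (nat \<times> nat \<Rightarrow> nat \<times> nat) \<Rightarrow> (nat \<times> nat) set" where
  "slides d \<sigma> = {(a, b). a \<in> asterisks d \<sigma> \<and> b \<in> asterisks d \<sigma> \<and> a + 2 \<le> b \<and>
     (\<forall>k. a < k \<and> k < b \<longrightarrow> k \<notin> asterisks d \<sigma>)}"

definition A_set :: "nat \<Rightarrow> nat \<Rightarrow> (nat \<times> nat \<Rightarrow> nat \<times> nat) set" where
  "A_set d r = {\<sigma> \<in> colored_perms d r. win_col d \<sigma> 1 = 0}"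

definition A_col :: "nat \<Rightarrow> nat \<Rightarrow> nat \<Rightarrow> (nat \<times> nat \<Rightarrow> nat \<times> nat) set" where
  "A_col d r s = {\<sigma> \<in> A_set d r. win_col d \<sigma> d = s}"

definition A_neq :: "nat \<Rightarrow> nat \<Rightarrow> (nat \<times> nat \<Rightarrow> nat \<times> nat) set" where
  "A_neq d r = {\<sigma> \<in> A_set d r. win_col d \<sigma> d \<noteq> 0}"

definition A_col_poly :: "nat \<Rightarrow> nat \<Rightarrow> nat \<Rightarrow> real poly" where
  "A_col_poly d r s = (\<Sum>\<sigma>\<in>A_col d r s. monom 1 (des d \<sigma>))"

definition A_neq_poly :: "nat \<Rightarrow> nat \<Rightarrow> real poly" where
  "A_neq_poly d r = (\<Sum>s = 1..r - 1. A_col_poly d r s)"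

definition a_zero :: "nat \<Rightarrow> nat \<Rightarrow> nat \<Rightarrow> nat" where
  "a_zero d r i = card {\<sigma> \<in> A_col d r 0. des d \<sigma> = i \<and> card (slides d \<sigma>) = i + 1}"

definition a_neq :: "nat \<Rightarrow> nat \<Rightarrow> nat \<Rightarrow> nat" where
  "a_neq d r i = card {\<sigma> \<in> A_neq d r. des d \<sigma> = i \<and> card (slides d \<sigma>) = i + 1}"

text \<open>Here \<open>n\<close> is twice the centre of symmetry, \<open>p(t) = t\<^sup>n p(1/t)\<close>; it is the degree of \<open>p\<close> only
  if the constant coefficient of \<open>p\<close> does not vanish.\<close>

definition symmetric_poly :: "nat \<Rightarrow> real poly \<Rightarrow> bool" where
  "symmetric_poly n p \<longleftrightarrow> degree p \<le> n \<and> (\<forall>i\<le>n. coeff p i = coeff p (n - i))"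

definition gamma_sum :: "nat \<Rightarrow> (nat \<Rightarrow> real) \<Rightarrow> real poly" where
  "gamma_sum n \<gamma> = (\<Sum>i = 0..n div 2. smult (\<gamma> i) (monom 1 i * [:1, 1:] ^ (n - 2 * i)))"

definition gamma_nonnegative :: "nat \<Rightarrow> real poly \<Rightarrow> bool" where
  "gamma_nonnegative n p \<longleftrightarrow> symmetric_poly n p \<and>
     (\<exists>\<gamma>. p = gamma_sum n \<gamma> \<and> (\<forall>i\<le>n div 2. \<gamma> i \<ge> 0))"

text \<open>The coefficients \<open>\<gamma>\<^sub>i\<close> are unique, so the existential quantifier above ranges over the one
  \<open>\<gamma>\<close>-expansion of \<open>p\<close>.\<close>

lemma gamma_sum_unique:
  assumes "gamma_sum n f = gamma_sum n g" "i \<le> n div 2"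
  shows "f i = g i"
  using assms(2)
proof (induction i rule: less_induct)
  case (less k)
  let ?q = "\<lambda>i. monom 1 i * [:1, 1:] ^ (n - 2 * i) :: real poly"
  have diag: "coeff (?q k) k = 1"
    by (simp add: coeff_monom_mult coeff_0_power)
  have split: "{0..n div 2} = insert k ({0..<k} \<union> {k<..n div 2})"
    using less.prems by auto
  have expand: "coeff (gamma_sum n h) k = h k + (\<Sum>i = 0..<k. h i * coeff (?q i) k)" for h
  proof -
    have "coeff (gamma_sum n h) k = (\<Sum>i = 0..n div 2. h i * coeff (?q i) k)"
      by (simp add: gamma_sum_def coeff_sum)
    also have "\<dots> = h k * coeff (?q k) k + (\<Sum>i\<in>{0..<k} \<union> {k<..n div 2}. h i * coeff (?q i) k)"
      unfolding split by (subst sum.insert) auto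
    also have "(\<Sum>i\<in>{0..<k} \<union> {k<..n div 2}. h i * coeff (?q i) k) =
        (\<Sum>i = 0..<k. h i * coeff (?q i) k)"
      by (rule sum.mono_neutral_right) (auto simp: coeff_monom_mult)
    finally show ?thesis using diag by simp
  qed
  have "(\<Sum>i = 0..<k. f i * coeff (?q i) k) = (\<Sum>i = 0..<k. g i * coeff (?q i) k)"
    using less by (intro sum.cong) auto
  with expand[of f] expand[of g] assms(1) show ?case by simp
qed

end

theory Submission
  imports Defs "HOL-Combinatorics.Multiset_Permutations"
begin

text \<open>
  Encode the coloured letters order-preservingly as nonzero integers, colour \<open>0\<close> negative and the other
  colours positive; both end entries of the word then become \<open>0\<close>. Give each letter of
  \<open>0, w\<^sub>1, \<dots>, w\<^sub>d, 0\<close> the weight \<open>t\<close> if it is a peak, \<open>1\<close> if it is a valley, \<open>\<alpha>\<close> if it is a double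
  descent and \<open>\<beta>\<close> if it is a double ascent. The total weight of all arrangements of a fixed set of
  letters, with prescribed signs of the first and last letter, depends only on \<open>\<alpha> + \<beta>\<close>: a word is a
  concatenation of blocks of constant sign whose weights multiply, and for one block splitting at the
  letter nearest to \<open>0\<close> gives a recursion in which \<open>\<alpha>\<close> and \<open>\<beta>\<close> enter only through \<open>\<alpha> + \<beta>\<close>.
  The choice \<open>(\<alpha>, \<beta>) = (t, 1)\<close> counts descents; the choice \<open>(0, 1 + t)\<close> gives the
  \<open>\<gamma>\<close>-expansion, since the words without double descents are those in which every slide has length
  two, that is, with one more slide than descents.
\<close>

section \<open>Weights of integer words\<close>

text \<open>The two flags tell whether the letter is entered and left by an ascent.\<close>

definition letter_wt :: "'a::comm_ring_1 \<Rightarrow> 'a \<Rightarrow> 'a \<Rightarrow> bool \<Rightarrow> bool \<Rightarrow> 'a" where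
  "letter_wt t \<alpha> \<beta> p q = (if p then (if q then \<beta> else t) else (if q then 1 else \<alpha>))"

text \<open>The bounds \<open>a\<close> and \<open>b\<close> are the neighbours of the word and
  carry no weight themselves. As parameters they let a piece of a longer word be weighed in its
  context.\<close>

primrec word_wt :: "'a::comm_ring_1 \<Rightarrow> 'a \<Rightarrow> 'a \<Rightarrow> int \<Rightarrow> int list \<Rightarrow> int \<Rightarrow> 'a" where
  "word_wt t \<alpha> \<beta> a [] b = 1"
| "word_wt t \<alpha> \<beta> a (x # w) b =
     letter_wt t \<alpha> \<beta> (a < x) (x < hd (w @ [b])) * word_wt t \<alpha> \<beta> x w b"

text \<open>Weights are local: a letter sees only its two neighbours, so each piece needs only the
  letter just across the cut, or the outer bound if the other piece is empty.\<close>

lemma word_wt_append: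
  "word_wt t \<alpha> \<beta> a (u @ v) b =
     word_wt t \<alpha> \<beta> a u (hd (v @ [b])) * word_wt t \<alpha> \<beta> (last (a # u)) v b"
proof (induction u arbitrary: a)
  case (Cons x u)
  have "hd ((u @ v) @ [b]) = hd (u @ [hd (v @ [b])])" by (cases u) auto
  with Cons show ?case by (simp add: mult.assoc)
qed simp

text \<open>The bounds enter only through comparisons with the end letters. This serves to replace a
  bound by \<open>0\<close>.\<close>

lemma word_wt_cong_bounds:
  assumes "\<And>x. x \<in> set w \<Longrightarrow> (a < x) = (a' < x)" "\<And>x. x \<in> set w \<Longrightarrow> (x < b) = (x < b')"
  shows "word_wt t \<alpha> \<beta> a w b = word_wt t \<alpha> \<beta> a' w b'"
  using assms
proof (induction w arbitrary: a a')
  case (Cons x w)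
  have "word_wt t \<alpha> \<beta> x w b = word_wt t \<alpha> \<beta> x w b'"
    using Cons.prems by (intro Cons.IH) auto
  moreover have "(x < hd (w @ [b])) = (x < hd (w @ [b']))"
    using Cons.prems(2) by (cases w) auto
  ultimately show ?case using Cons.prems(1)[of x] by simp
qed simp

lemma word_wt_conv_prod:
  "word_wt t \<alpha> \<beta> a w b =
     (\<Prod>i<length w. letter_wt t \<alpha> \<beta> ((a # w @ [b]) ! i < (a # w @ [b]) ! Suc i)
        ((a # w @ [b]) ! Suc i < (a # w @ [b]) ! Suc (Suc i)))"
proof (induction w arbitrary: a)
  case (Cons x w)
  have "hd (w @ [b]) = (w @ [b]) ! 0" by (cases w) auto
  then show ?case
    by (simp only: length_Cons prod.lessThan_Suc_shift word_wt.simps Cons.IH) simp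
qed simp

section \<open>Arrangements of letters of one sign\<close>

definition perm_wt :: "'a::comm_ring_1 \<Rightarrow> 'a \<Rightarrow> 'a \<Rightarrow> int set \<Rightarrow> 'a" where
  "perm_wt t \<alpha> \<beta> S = (\<Sum>w\<in>permutations_of_set S. word_wt t \<alpha> \<beta> 0 w 0)"

text \<open>Since \<open>m\<close> occurs once, cutting there is reversible. Summing over the letter
  set \<open>U\<close> of the left part first makes the arrangements of the two parts
  independent.\<close>

lemma sum_permutations_insert_split:
  assumes "finite S" "m \<notin> S"
  shows "(\<Sum>w\<in>permutations_of_set (insert m S). f w) =
    (\<Sum>U\<in>Pow S. \<Sum>u\<in>permutations_of_set U. \<Sum>v\<in>permutations_of_set (S - U). f (u @ m # v))"
proof -
  let ?I = "SIGMA U:Pow S. permutations_of_set U \<times> permutations_of_set (S - U)"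
  let ?u = "takeWhile (\<lambda>x. x \<noteq> m)" and ?v = "\<lambda>w. tl (dropWhile (\<lambda>x. x \<noteq> m) w)"
  have split: "?u (u @ m # v) = u \<and> ?v (u @ m # v) = v" if "m \<notin> set u" for u v
  proof -
    have "\<forall>y\<in>set u. y \<noteq> m" using that by auto
    then show ?thesis by (simp add: takeWhile_append2 dropWhile_append2)
  qed
  have "(\<Sum>w\<in>permutations_of_set (insert m S). f w) = (\<Sum>(U, u, v)\<in>?I. f (u @ m # v))"
  proof (rule sum.reindex_bij_witness[where i = "\<lambda>(U, u, v). u @ m # v" and
        j = "\<lambda>w. (set (?u w), ?u w, ?v w)"])
    fix w assume w: "w \<in> permutations_of_set (insert m S)"
    then have "m \<in> set w" by (auto simp: permutations_of_set_def)
    then obtain u v where uv: "w = u @ m # v" "m \<notin> set u" by (meson split_list_first)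
    have "set u \<union> set v = S" "distinct u" "distinct v" "set u \<inter> set v = {}"
      using w assms unfolding uv(1) permutations_of_set_def by auto
    then show "(set (?u w), ?u w, ?v w) \<in> ?I"
      using uv split[OF uv(2), of v] by (auto simp: permutations_of_set_def)
    show "(case (set (?u w), ?u w, ?v w) of (U, u, v) \<Rightarrow> u @ m # v) = w"
      and "(case (set (?u w), ?u w, ?v w) of (U, u, v) \<Rightarrow> f (u @ m # v)) = f w"
      using uv split[OF uv(2), of v] by simp_all
  next
    fix x assume "x \<in> ?I"
    then obtain U u v where x: "x = (U, u, v)" "U \<subseteq> S" "set u = U" "set v = S - U"
        "distinct u" "distinct v" by (auto simp: permutations_of_set_def)
    then have "m \<notin> set u" using assms by auto
    with x split[of u v] show "(set (?u (case x of (U, u, v) \<Rightarrow> u @ m # v)),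
        ?u (case x of (U, u, v) \<Rightarrow> u @ m # v), ?v (case x of (U, u, v) \<Rightarrow> u @ m # v)) = x"
      by simp
    show "(case x of (U, u, v) \<Rightarrow> u @ m # v) \<in> permutations_of_set (insert m S)"
      using x assms by (auto simp: permutations_of_set_def)
  qed
  also have "\<dots> = (\<Sum>U\<in>Pow S. \<Sum>u\<in>permutations_of_set U.
      \<Sum>v\<in>permutations_of_set (S - U). f (u @ m # v))"
    using assms by (simp add: sum.Sigma sum.cartesian_product)
  finally show ?thesis .
qed

text \<open>The letter \<open>m\<close> is nearest to \<open>0\<close>, so every other letter compares with it as with the end
  entries. At one end of the word it is a double descent, at the other a double ascent.\<close>

lemma perm_wt_insert:
  assumes "finite S" "m \<notin> S" "S \<noteq> {}"
    and "(\<forall>x\<in>S. x < m) \<and> m < 0 \<or> (\<forall>x\<in>S. m < x) \<and> 0 < m"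
  shows "perm_wt t \<alpha> \<beta> (insert m S) = (\<alpha> + \<beta>) * perm_wt t \<alpha> \<beta> S +
    (if m < 0 then t else 1) * (\<Sum>U\<in>Pow S - {{}, S}. perm_wt t \<alpha> \<beta> U * perm_wt t \<alpha> \<beta> (S - U))"
proof -
  \<comment> \<open>\<open>c U\<close> is the weight of \<open>m\<close> itself. At the front a
    negative \<open>m\<close> is a double descent and at the back a double ascent; for a positive
    \<open>m\<close> it is the reverse. Elsewhere a negative \<open>m\<close> is a peak and a
    positive one a valley.\<close>
  define c where "c U = (if U = {} then (if m < 0 then \<alpha> else \<beta>) else
    if U = S then (if m < 0 then \<beta> else \<alpha>) else (if m < 0 then t else 1))" for U
  have wt: "word_wt t \<alpha> \<beta> 0 (u @ m # v) 0 = c U * (word_wt t \<alpha> \<beta> 0 u 0 * word_wt t \<alpha> \<beta> 0 v 0)"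
    if "U \<subseteq> S" "u \<in> permutations_of_set U" "v \<in> permutations_of_set (S - U)" for U u v
  proof -
    have su: "set u = U" and sv: "set v = S - U" using that by (auto simp: permutations_of_set_def)
    have lt: "(m < x) = (0 < x)" "(x < m) = (x < 0)" if "x \<in> S" for x
      using assms(4) that by force+
    have "word_wt t \<alpha> \<beta> 0 u m = word_wt t \<alpha> \<beta> 0 u 0" "word_wt t \<alpha> \<beta> m v 0 = word_wt t \<alpha> \<beta> 0 v 0"
      using su sv \<open>U \<subseteq> S\<close> lt by (auto intro!: word_wt_cong_bounds)
    moreover have "letter_wt t \<alpha> \<beta> (last (0 # u) < m) (m < hd (v @ [0])) = c U"
    proof -
      have l: "last (0 # u) = (if U = {} then 0 else last u)" "U \<noteq> {} \<Longrightarrow> last u \<in> S"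
        using su \<open>U \<subseteq> S\<close> last_in_set[of u] by auto
      have h: "hd (v @ [0]) = (if U = S then 0 else hd v)" "U \<noteq> S \<Longrightarrow> hd v \<in> S"
        using sv \<open>U \<subseteq> S\<close> by (cases v; auto)+
      have "(last (0 # u) < m) = (if U = {} then 0 < m else m < 0)"
        using l(2) assms(4) unfolding l(1) by (auto dest!: bspec)
      moreover have "(m < hd (v @ [0])) = (if U = S then m < 0 else 0 < m)"
        using h(2) assms(4) unfolding h(1) by (auto dest!: bspec)
      moreover have "(0 < m) = (\<not> m < 0)" using assms(4) by auto
      ultimately show ?thesis using assms(3) by (simp add: c_def letter_wt_def del: last.simps)
    qed
    ultimately show ?thesis by (simp add: word_wt_append mult_ac del: last.simps)
  qed
  have "perm_wt t \<alpha> \<beta> (insert m S) = (\<Sum>U\<in>Pow S. c U * (perm_wt t \<alpha> \<beta> U * perm_wt t \<alpha> \<beta> (S - U)))"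
    unfolding perm_wt_def sum_permutations_insert_split[OF assms(1,2)] sum_product
    unfolding sum_distrib_left
    by (intro sum.cong refl wt) auto
  \<comment> \<open>The two extreme positions of \<open>m\<close> contribute \<open>\<alpha>\<close>
    and \<open>\<beta>\<close>, in an order depending on its sign, each times the weight of
    \<open>S\<close>. Only \<open>\<alpha> + \<beta>\<close> survives.\<close>
  also have "\<dots> = (\<Sum>U\<in>{{}, S}. c U * (perm_wt t \<alpha> \<beta> U * perm_wt t \<alpha> \<beta> (S - U))) +
      (\<Sum>U\<in>Pow S - {{}, S}. c U * (perm_wt t \<alpha> \<beta> U * perm_wt t \<alpha> \<beta> (S - U)))"
    using assms by (subst sum.subset_diff[of "{{}, S}"]) (auto simp: add.commute)
  also have "(\<Sum>U\<in>Pow S - {{}, S}. c U * (perm_wt t \<alpha> \<beta> U * perm_wt t \<alpha> \<beta> (S - U))) =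
      (if m < 0 then t else 1) * (\<Sum>U\<in>Pow S - {{}, S}. perm_wt t \<alpha> \<beta> U * perm_wt t \<alpha> \<beta> (S - U))"
    unfolding sum_distrib_left by (intro sum.cong) (auto simp: c_def)
  also have "(\<Sum>U\<in>{{}, S}. c U * (perm_wt t \<alpha> \<beta> U * perm_wt t \<alpha> \<beta> (S - U))) = (\<alpha> + \<beta>) * perm_wt t \<alpha> \<beta> S"
    using assms(3) by (simp add: c_def perm_wt_def algebra_simps)
  finally show ?thesis .
qed

text \<open>Strong induction: removing the letter nearest to \<open>0\<close> leaves sums over
  nonempty smaller blocks, with \<open>\<alpha>\<close> and \<open>\<beta>\<close> visible only
  through their sum. A single letter is a valley or a peak, of weight \<open>1\<close> or
  \<open>t\<close>.\<close>

lemma perm_wt_block_eq: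
  assumes "finite S" "S \<noteq> {}" "(\<forall>x\<in>S. x < 0) \<or> (\<forall>x\<in>S. 0 < x)" "\<alpha> + \<beta> = \<alpha>' + \<beta>'"
  shows "perm_wt t \<alpha> \<beta> S = perm_wt t \<alpha>' \<beta>' S"
  using assms(1-3)
proof (induction S rule: finite_psubset_induct)
  case (psubset S)
  define m where "m = (if \<forall>x\<in>S. x < 0 then Max S else Min S)"
  have mS: "m \<in> S" using psubset by (auto simp: m_def)
  define R where "R = S - {m}"
  have S: "S = insert m R" "finite R" "m \<notin> R" using mS psubset by (auto simp: R_def)
  have m: "(\<forall>x\<in>R. x < m) \<and> m < 0 \<or> (\<forall>x\<in>R. m < x) \<and> 0 < m"
  proof (cases "\<forall>x\<in>S. x < 0")
    case True
    then have "\<forall>x\<in>R. x < m" using psubset.hyps by (auto simp: m_def R_def order_less_le)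
    with True mS show ?thesis by auto
  next
    case False
    then have "\<forall>x\<in>R. m < x" using psubset.hyps by (auto simp: m_def R_def order_less_le)
    with False mS psubset.prems show ?thesis by auto
  qed
  show ?case
  proof (cases "R = {}")
    case True
    with m show ?thesis by (auto simp: S(1) perm_wt_def letter_wt_def)
  next
    case False
    have IH: "perm_wt t \<alpha> \<beta> U = perm_wt t \<alpha>' \<beta>' U" if "U \<subseteq> R" "U \<noteq> {}" for U
      using that S psubset.prems by (intro psubset.IH) auto
    have "(\<Sum>U\<in>Pow R - {{}, R}. perm_wt t \<alpha> \<beta> U * perm_wt t \<alpha> \<beta> (R - U)) =
        (\<Sum>U\<in>Pow R - {{}, R}. perm_wt t \<alpha>' \<beta>' U * perm_wt t \<alpha>' \<beta>' (R - U))"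
      by (intro sum.cong refl arg_cong2[of _ _ _ _ times] IH) auto
    then show ?thesis
      unfolding S(1) perm_wt_insert[OF S(2,3) False m] IH[OF subset_refl False] assms(4) by simp
  qed
qed

section \<open>Words with prescribed signs at both ends\<close>

definition signed_perms :: "bool \<Rightarrow> bool \<Rightarrow> int set \<Rightarrow> int list set" where
  "signed_perms s e S =
     {w \<in> permutations_of_set S. w \<noteq> [] \<and> (hd w < 0) = s \<and> (last w < 0) = e}"

lemma finite_signed_perms: "finite S \<Longrightarrow> finite (signed_perms s e S)"
  by (auto simp: signed_perms_def)

text \<open>Here \<open>u\<close> is the first maximal block of sign \<open>s\<close>. The rest may
  be empty only if this block is also the last one, whence \<open>s = e\<close>. The letters meeting
  at the cut have opposite signs, so each compares with the other as with \<open>0\<close>; this is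
  why the weights multiply.\<close>

lemma signed_perms_append:
  assumes "finite S" "U \<subseteq> S" "U \<noteq> {}" "\<forall>x\<in>U. (x < 0) = s" "u \<in> permutations_of_set U"
    and "v \<in> (if U = S then (if s = e then {[]} else {}) else signed_perms (\<not> s) e (S - U))"
  shows "u @ v \<in> signed_perms s e S"
    and "takeWhile (\<lambda>x. (x < 0) = s) (u @ v) = u" and "dropWhile (\<lambda>x. (x < 0) = s) (u @ v) = v"
    and "0 \<notin> S \<Longrightarrow> word_wt t \<alpha> \<beta> 0 (u @ v) 0 = word_wt t \<alpha> \<beta> 0 u 0 * word_wt t \<alpha> \<beta> 0 v 0"
proof -
  have u: "set u = U" "distinct u" "u \<noteq> []" using assms by (auto simp: permutations_of_set_def)
  have all: "\<forall>x\<in>set u. (x < 0) = s" using u assms by simp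
  have hl: "hd u \<in> U" "last u \<in> U" using u by auto
  have v: "set v = S - U" "distinct v" "v \<noteq> [] \<Longrightarrow> (hd v < 0) = (\<not> s) \<and> (last v < 0) = e" "v = [] \<Longrightarrow> s = e"
    using assms(2,6) by (auto simp: signed_perms_def permutations_of_set_def split: if_splits)
  show "u @ v \<in> signed_perms s e S"
    using u v assms(2) all hl by (cases "v = []") (auto simp: signed_perms_def permutations_of_set_def)
  have "takeWhile (\<lambda>x. (x < 0) = s) v = []" "dropWhile (\<lambda>x. (x < 0) = s) v = v"
    using v(3) by (cases v; simp)+
  then show "takeWhile (\<lambda>x. (x < 0) = s) (u @ v) = u" "dropWhile (\<lambda>x. (x < 0) = s) (u @ v) = v"
    using all by (simp_all add: takeWhile_append2 dropWhile_append2)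
  assume "0 \<notin> S"
  have nz: "x \<noteq> 0" if "x \<in> set u \<union> set v" for x
    using that u v assms(2) \<open>0 \<notin> S\<close> by auto
  have "word_wt t \<alpha> \<beta> 0 u (hd (v @ [0])) = word_wt t \<alpha> \<beta> 0 u 0"
  proof (cases v)
    case (Cons y v')
    with v(3) nz have y: "(y < 0) = (\<not> s)" "y \<noteq> 0" by auto
    have "(x < y) = (x < 0)" if "x \<in> set u" for x
      using y that all nz[of x] by auto
    with Cons show ?thesis by (intro word_wt_cong_bounds) simp_all
  qed simp
  moreover have "word_wt t \<alpha> \<beta> (last u) v 0 = word_wt t \<alpha> \<beta> 0 v 0"
  proof (cases v)
    case (Cons y v')
    with v(3) nz have y: "(y < 0) = (\<not> s)" "y \<noteq> 0" by auto
    have "(last u < y) = (0 < y)"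
      using y bspec[OF all last_in_set[OF u(3)]] by auto
    with Cons show ?thesis by simp
  qed simp
  ultimately show "word_wt t \<alpha> \<beta> 0 (u @ v) 0 = word_wt t \<alpha> \<beta> 0 u 0 * word_wt t \<alpha> \<beta> 0 v 0"
    using u(3) by (simp add: word_wt_append)
qed

text \<open>Peeling off the first maximal block is reversible, and a nonempty rest is again a word
  with prescribed end signs, on fewer letters and with the first sign flipped. This prepares an
  induction on \<open>S\<close>.\<close>

lemma sum_signed_perms_split:
  assumes "finite S"
  shows "(\<Sum>w\<in>signed_perms s e S. f w) =
    (\<Sum>U\<in>Pow {x \<in> S. (x < 0) = s} - {{}}. \<Sum>u\<in>permutations_of_set U.
       \<Sum>v\<in>(if U = S then (if s = e then {[]} else {}) else signed_perms (\<not> s) e (S - U)).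
         f (u @ v))"
proof -
  let ?V = "\<lambda>U. if U = S then (if s = e then {[]} else {}) else signed_perms (\<not> s) e (S - U)"
  let ?I = "SIGMA U:Pow {x \<in> S. (x < 0) = s} - {{}}. permutations_of_set U \<times> ?V U"
  let ?u = "takeWhile (\<lambda>x. (x < 0) = s)" and ?v = "dropWhile (\<lambda>x. (x < 0) = s)"
  have "(\<Sum>w\<in>signed_perms s e S. f w) = (\<Sum>(U, u, v)\<in>?I. f (u @ v))"
  proof (rule sum.reindex_bij_witness[where i = "\<lambda>(U, u, v). u @ v" and
        j = "\<lambda>w. (set (?u w), ?u w, ?v w)"])
    fix w assume "w \<in> signed_perms s e S"
    then have w: "set w = S" "distinct w" "w \<noteq> []" "(hd w < 0) = s" "(last w < 0) = e"
      by (auto simp: signed_perms_def permutations_of_set_def)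
    define u v where "u = ?u w" and "v = ?v w"
    have uv: "w = u @ v" by (simp add: u_def v_def)
    have "u \<noteq> []" using w by (cases w) (auto simp: u_def)
    have u: "\<forall>x\<in>set u. (x < 0) = s" by (auto simp: u_def dest: set_takeWhileD)
    have v: "(hd v < 0) = (\<not> s)" if "v \<noteq> []" using that hd_dropWhile[of "\<lambda>x. (x < 0) = s" w]
      by (auto simp: v_def)
    have Un: "S = set u \<union> set v" "set u \<inter> set v = {}" using w(1,2) unfolding uv by auto
    then have S: "S - set u = set v" "set u \<subseteq> S" by auto
    have full: "set u = S \<longleftrightarrow> v = []" using Un by (cases v) auto
    have "v \<in> ?V (set u)"
    proof (cases "v = []")
      case True
      then have "last w \<in> set u" using uv \<open>u \<noteq> []\<close> by simp
      with u w(5) True full show ?thesis by auto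
    next
      case False
      then have "v \<in> signed_perms (\<not> s) e (S - set u)"
        using v w(2,5) S(1) uv by (auto simp: signed_perms_def permutations_of_set_def)
      with False full show ?thesis by simp
    qed
    moreover have "set u \<in> Pow {x \<in> S. (x < 0) = s} - {{}}" "u \<in> permutations_of_set (set u)"
      using u S(2) w(2) uv \<open>u \<noteq> []\<close> by (auto simp: permutations_of_set_def)
    ultimately have "(set u, u, v) \<in> ?I" by blast
    then show "(set (?u w), ?u w, ?v w) \<in> ?I" by (simp only: u_def v_def)
  next
    fix x assume "x \<in> ?I"
    then obtain U u v where x: "x = (U, u, v)" "U \<subseteq> S" "U \<noteq> {}" "\<forall>x\<in>U. (x < 0) = s"
        "u \<in> permutations_of_set U" "v \<in> ?V U" by blast
    note app = signed_perms_append[OF assms x(2-6)]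
    have "set u = U" using x by (simp add: permutations_of_set_def)
    with app(2,3) x(1) show "(set (?u (case x of (U, u, v) \<Rightarrow> u @ v)), ?u (case x of (U, u, v) \<Rightarrow> u @ v),
        ?v (case x of (U, u, v) \<Rightarrow> u @ v)) = x" by simp
    show "(case x of (U, u, v) \<Rightarrow> u @ v) \<in> signed_perms s e S" using app(1) x(1) by simp
  qed simp_all
  also have "\<dots> = (\<Sum>U\<in>Pow {x \<in> S. (x < 0) = s} - {{}}. \<Sum>u\<in>permutations_of_set U.
       \<Sum>v\<in>?V U. f (u @ v))"
    using assms by (simp add: sum.Sigma sum.cartesian_product finite_signed_perms)
  finally show ?thesis .
qed

text \<open>The first block is handled by \<open>perm_wt_block_eq\<close>, the rest by induction on
  the letter set. The sign \<open>s\<close> must be general because it alternates from block to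
  block, while \<open>e\<close> stays fixed.\<close>

lemma sum_signed_perms_word_wt_eq:
  assumes "finite S" "0 \<notin> S" "\<alpha> + \<beta> = \<alpha>' + \<beta>'"
  shows "(\<Sum>w\<in>signed_perms s e S. word_wt t \<alpha> \<beta> 0 w 0) =
    (\<Sum>w\<in>signed_perms s e S. word_wt t \<alpha>' \<beta>' 0 w 0)"
  using assms(1,2)
proof (induction S arbitrary: s rule: finite_psubset_induct)
  case (psubset S)
  let ?V = "\<lambda>U. if U = S then (if s = e then {[]} else {}) else signed_perms (\<not> s) e (S - U)"
  \<comment> \<open>For fixed \<open>U\<close> the weight is a product, so summing over the
    arrangements of the block gives the factor \<open>perm_wt\<close>.\<close>
  have expand: "(\<Sum>w\<in>signed_perms s e S. word_wt t \<alpha> \<beta> 0 w 0) =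
      (\<Sum>U\<in>Pow {x \<in> S. (x < 0) = s} - {{}}. perm_wt t \<alpha> \<beta> U * (\<Sum>v\<in>?V U. word_wt t \<alpha> \<beta> 0 v 0))"
    for \<alpha> \<beta>
    unfolding sum_signed_perms_split[OF psubset.hyps] perm_wt_def sum_product
    using psubset.hyps psubset.prems
    by (intro sum.cong refl signed_perms_append(4)[of S _ s _ _ e]) auto
  show ?case
    unfolding expand
  proof (rule sum.cong[OF refl])
    fix U assume U: "U \<in> Pow {x \<in> S. (x < 0) = s} - {{}}"
    then have "\<forall>x\<in>U. x \<noteq> 0 \<and> (x < 0) = s" using psubset.prems by auto
    then have "(\<forall>x\<in>U. x < 0) \<or> (\<forall>x\<in>U. 0 < x)" by (metis linorder_neqE_linordered_idom)
    then have "perm_wt t \<alpha> \<beta> U = perm_wt t \<alpha>' \<beta>' U"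
      using U psubset.hyps assms(3) by (intro perm_wt_block_eq) (auto intro: finite_subset)
    moreover have "(\<Sum>v\<in>?V U. word_wt t \<alpha> \<beta> 0 v 0) = (\<Sum>v\<in>?V U. word_wt t \<alpha>' \<beta>' 0 v 0)"
    proof (cases "U = S")
      case False
      have "S - U \<subset> S" using U by auto
      from psubset.IH[OF this, of "\<not> s"] show ?thesis using False psubset.prems by simp
    qed simp
    ultimately show "perm_wt t \<alpha> \<beta> U * (\<Sum>v\<in>?V U. word_wt t \<alpha> \<beta> 0 v 0) =
        perm_wt t \<alpha>' \<beta>' U * (\<Sum>v\<in>?V U. word_wt t \<alpha>' \<beta>' 0 v 0)" by (simp only:)
  qed
qed

section \<open>Coloured permutations as integer words\<close>

text \<open>Colour \<open>0\<close> fills \<open>-d, ..., -1\<close> and colour \<open>c > 0\<close>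
  fills \<open>c * d + 1, ..., c * d + d\<close>. Both end entries of the word have colour
  \<open>0\<close> and a value above \<open>d\<close>, so they lie between these two ranges and are
  represented by \<open>0\<close>.\<close>

definition code :: "nat \<Rightarrow> nat \<times> nat \<Rightarrow> int" where
  "code d x = (if snd x = 0 then int (fst x) - int d - 1 else int (snd x * d + fst x))"

lemma code_less_iff:
  assumes "x \<in> {1..d} \<times> {0..<r}" "y \<in> {1..d} \<times> {0..<r}"
  shows "code d x < code d y \<longleftrightarrow> snd x < snd y \<or> snd x = snd y \<and> fst x < fst y"
proof -
  have *: "c * d + v < c' * d + v'" if "c < c'" "v \<le> d" "1 \<le> v'" for c c' v v' :: nat
  proof -
    have "c * d + v \<le> Suc c * d" using that by simp
    also have "\<dots> \<le> c' * d" using that by (intro mult_right_mono) auto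
    finally show ?thesis using that by simp
  qed
  have "code d x < code d y" if "snd x < snd y" "x \<in> {1..d} \<times> {0..<r}" "y \<in> {1..d} \<times> {0..<r}" for x y
    using *[of "snd x" "snd y" "fst x" "fst y"] that by (auto simp: code_def mem_Times_iff simp flip: of_nat_mult of_nat_add)
  from this[of x y] this[of y x] assms show ?thesis
    by (cases "snd x" "snd y" rule: linorder_cases) (auto simp: code_def)
qed

lemma code_inj_on: "inj_on (code d) ({1..d} \<times> {0..<r})"
proof (rule inj_onI)
  fix x y assume "x \<in> {1..d} \<times> {0..<r}" "y \<in> {1..d} \<times> {0..<r}" "code d x = code d y"
  with code_less_iff[of x d r y] code_less_iff[of y d r x] show "x = y"
    by (cases x; cases y) auto
qed

lemma code_neg_iff: "x \<in> {1..d} \<times> {0..<r} \<Longrightarrow> code d x < 0 \<longleftrightarrow> snd x = 0"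
  and code_nonzero: "x \<in> {1..d} \<times> {0..<r} \<Longrightarrow> code d x \<noteq> 0"
  by (auto simp: code_def mem_Times_iff simp flip: of_nat_mult of_nat_add)

definition code_word :: "nat \<Rightarrow> (nat \<times> nat \<Rightarrow> nat \<times> nat) \<Rightarrow> int list" where
  "code_word d \<sigma> = map (\<lambda>i. code d (\<sigma> (i, 0))) [1..<Suc d]"

lemma length_code_word [simp]: "length (code_word d \<sigma>) = d"
  by (simp add: code_word_def)

lemma code_word_nth: "i < d \<Longrightarrow> code_word d \<sigma> ! i = code d (\<sigma> (Suc i, 0))"
  by (simp add: code_word_def del: upt_Suc)

lemma finite_colored_perms: "finite (colored_perms d r)"
  by (rule finite_subset[OF _ finite_permutations[of "{1..d} \<times> {0..<r}"]])
    (auto simp: colored_perms_def)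

lemma colored_perms_in:
  "\<sigma> \<in> colored_perms d r \<Longrightarrow> i \<in> {1..d} \<Longrightarrow> s < r \<Longrightarrow> \<sigma> (i, s) \<in> {1..d} \<times> {0..<r}"
  using permutes_in_image[of \<sigma> "{1..d} \<times> {0..<r}" "(i, s)"] by (auto simp: colored_perms_def)

lemma distinct_code_word:
  assumes "\<sigma> \<in> colored_perms d r" "r \<ge> 1"
  shows "distinct (code_word d \<sigma>)"
proof -
  have "inj \<sigma>" using assms by (auto simp: colored_perms_def permutes_inj)
  then have "inj_on (\<lambda>i. code d (\<sigma> (i, 0))) {1..d}"
    using colored_perms_in[OF assms(1)] assms(2)
    by (intro inj_onI) (auto dest!: inj_onD[OF code_inj_on[of d r]] dest: injD)
  moreover have "set [1..<Suc d] = {1..d}" by auto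
  ultimately show ?thesis by (simp add: code_word_def distinct_map del: upt_Suc)
qed

lemma zero_notin_code_word:
  assumes "\<sigma> \<in> colored_perms d r" "r \<ge> 1"
  shows "0 \<notin> set (code_word d \<sigma>)"
  using colored_perms_in[OF assms(1)] code_nonzero[of _ d r] assms(2)
  by (fastforce simp: code_word_def simp del: upt_Suc)

text \<open>The word fixes the images of the letters of colour \<open>0\<close>; compatibility with
  the colour shift carries them to all other colours by induction.\<close>

lemma inj_on_code_word:
  assumes "r \<ge> 1"
  shows "inj_on (code_word d) (colored_perms d r)"
proof (rule inj_onI)
  fix \<sigma> \<tau> assume \<sigma>: "\<sigma> \<in> colored_perms d r" and \<tau>: "\<tau> \<in> colored_perms d r"
    and eq: "code_word d \<sigma> = code_word d \<tau>"
  have "\<sigma> (i, s) = \<tau> (i, s)" if "i \<in> {1..d}" "s < r" for i s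
    using that(2)
  proof (induction s)
    case 0
    have "code d (\<sigma> (i, 0)) = code d (\<tau> (i, 0))"
      using arg_cong[OF eq, of "\<lambda>w. w ! (i - 1)"] that(1) by (auto simp: code_word_nth)
    then show ?case
      using colored_perms_in[OF \<sigma> that(1)] colored_perms_in[OF \<tau> that(1)] 0
      by (intro inj_onD[OF code_inj_on[of d r]]) auto
  next
    case (Suc s)
    obtain j t where jt: "\<sigma> (i, s) = (j, t)" by force
    with Suc have "\<tau> (i, s) = (j, t)" by simp
    with jt have "\<sigma> (i, (s + 1) mod r) = \<tau> (i, (s + 1) mod r)"
      using \<sigma> \<tau> that(1) Suc.prems unfolding colored_perms_def by fastforce
    with Suc.prems show ?case by simp
  qed
  moreover have "\<sigma> x = \<tau> x" if "x \<notin> {1..d} \<times> {0..<r}" for x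
    using that \<sigma> \<tau> permutes_not_in unfolding colored_perms_def by (metis (lifting) mem_Collect_eq)
  ultimately show "\<sigma> = \<tau>" by (intro ext) (metis SigmaE atLeastLessThan_iff)
qed

text \<open>Moving positions while keeping colours commutes with the colour shift. Hence all
  arrangements of the letters of a coloured permutation are realised, as the sums over full sets of
  arrangements require.\<close>

lemma code_word_rearrange:
  assumes \<sigma>: "\<sigma> \<in> colored_perms d r" and r: "r \<ge> 1"
    and w: "w \<in> permutations_of_set (set (code_word d \<sigma>))"
  obtains \<tau> where "\<tau> \<in> colored_perms d r" "code_word d \<tau> = w"
proof -
  have "mset w = mset (code_word d \<sigma>)"
    using w distinct_code_word[OF \<sigma> r] by (auto simp: permutations_of_set_def set_eq_iff_mset_eq_distinct)
  then obtain \<pi> where \<pi>: "\<pi> permutes {..<d}" "permute_list \<pi> (code_word d \<sigma>) = w"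
    by (metis mset_eq_permutation length_code_word)
  let ?A = "{1..d} \<times> {0..<r}"
  \<comment> \<open>\<open>\<rho>\<close> applies \<open>\<pi>\<close> to the positions in every
    colour; \<open>Suc\<close> and \<open>- 1\<close> translate between positions from
    \<open>1\<close> and list indices from \<open>0\<close>.\<close>
  define \<rho> where "\<rho> x = (if x \<in> ?A then (Suc (\<pi> (fst x - 1)), snd x) else x)" for x
  have \<pi>_less: "\<pi> i < d" if "i < d" for i using permutes_in_image[OF \<pi>(1)] that by auto
  have "\<rho> ` ?A \<subseteq> ?A" using \<pi>_less by (auto simp: \<rho>_def Suc_le_eq)
  moreover have "inj_on \<rho> ?A"
  proof (rule inj_onI)
    fix x y assume "x \<in> ?A" "y \<in> ?A" "\<rho> x = \<rho> y"
    moreover from this have "\<pi> (fst x - 1) = \<pi> (fst y - 1)" by (auto simp: \<rho>_def)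
    then have "fst x - 1 = fst y - 1" using permutes_inj[OF \<pi>(1)] by (auto dest: injD)
    ultimately show "x = y" by (auto simp: \<rho>_def prod_eq_iff)
  qed
  ultimately have "bij_betw \<rho> ?A ?A"
    by (simp add: bij_betw_def endo_inj_surj)
  then have "\<rho> permutes ?A" by (rule bij_imp_permutes) (simp add: \<rho>_def)
  then have "(\<sigma> \<circ> \<rho>) permutes ?A"
    using \<sigma> by (auto simp: colored_perms_def intro: permutes_compose)
  moreover have "(\<sigma> \<circ> \<rho>) (i, (s + 1) mod r) = (j, (t + 1) mod r)"
    if "i \<in> {1..d}" "s \<in> {0..<r}" "(\<sigma> \<circ> \<rho>) (i, s) = (j, t)" for i s j t
  proof -
    have "Suc (\<pi> (i - 1)) \<in> {1..d}" using that(1) \<pi>_less[of "i - 1"] by fastforce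
    then show ?thesis using that \<sigma> r by (auto simp: \<rho>_def colored_perms_def)
  qed
  ultimately have "\<sigma> \<circ> \<rho> \<in> colored_perms d r" by (auto simp: colored_perms_def)
  moreover have "code_word d (\<sigma> \<circ> \<rho>) = w"
  proof (rule nth_equalityI)
    show "length (code_word d (\<sigma> \<circ> \<rho>)) = length w" using \<pi>(2) by auto
    fix i assume "i < length (code_word d (\<sigma> \<circ> \<rho>))"
    then have "i < d" by simp
    then have "w ! i = code_word d \<sigma> ! \<pi> i"
      using \<pi> by (metis length_code_word permute_list_nth)
    with \<open>i < d\<close> \<pi>_less[of i] r show "code_word d (\<sigma> \<circ> \<rho>) ! i = w ! i"
      by (simp add: code_word_nth \<rho>_def)
  qed
  ultimately show ?thesis by (rule that)
qed

definition colored_sign_class :: "nat \<Rightarrow> nat \<Rightarrow> bool \<Rightarrow> bool \<Rightarrow> (nat \<times> nat \<Rightarrow> nat \<times> nat) set" where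
  "colored_sign_class d r s e =
     {\<sigma> \<in> colored_perms d r. (hd (code_word d \<sigma>) < 0) = s \<and> (last (code_word d \<sigma>) < 0) = e}"

lemma code_word_image_sign_class:
  assumes "d \<ge> 1" "r \<ge> 1"
  shows "code_word d ` colored_sign_class d r s e =
    (\<Union>S\<in>(\<lambda>\<sigma>. set (code_word d \<sigma>)) ` colored_perms d r. signed_perms s e S)"
proof (intro equalityI subsetI)
  fix w assume "w \<in> code_word d ` colored_sign_class d r s e"
  then obtain \<sigma> where \<sigma>: "\<sigma> \<in> colored_perms d r" "w = code_word d \<sigma>"
    "(hd w < 0) = s" "(last w < 0) = e" by (auto simp: colored_sign_class_def)
  moreover have "w \<noteq> []" using \<sigma>(2) assms(1) length_code_word[of d \<sigma>] by (auto simp del: length_code_word)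
  ultimately have "w \<in> signed_perms s e (set (code_word d \<sigma>))"
    using distinct_code_word[OF \<sigma>(1) assms(2)] by (auto simp: signed_perms_def permutations_of_set_def)
  with \<sigma> show "w \<in> (\<Union>S\<in>(\<lambda>\<sigma>. set (code_word d \<sigma>)) ` colored_perms d r. signed_perms s e S)" by blast
next
  fix w assume "w \<in> (\<Union>S\<in>(\<lambda>\<sigma>. set (code_word d \<sigma>)) ` colored_perms d r. signed_perms s e S)"
  then obtain \<sigma> where \<sigma>: "\<sigma> \<in> colored_perms d r" "w \<in> signed_perms s e (set (code_word d \<sigma>))" by blast
  then have w: "w \<in> permutations_of_set (set (code_word d \<sigma>))" "(hd w < 0) = s" "(last w < 0) = e"
    by (auto simp: signed_perms_def)
  from code_word_rearrange[OF \<sigma>(1) assms(2) w(1)] obtain \<tau>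
    where "\<tau> \<in> colored_perms d r" "code_word d \<tau> = w" .
  with w show "w \<in> code_word d ` colored_sign_class d r s e" by (auto simp: colored_sign_class_def)
qed

text \<open>Sort the words by their letter set: different letter sets give disjoint sets of words,
  and for each letter set the invariance is already known.\<close>

lemma sum_sign_class_word_wt_eq:
  assumes "d \<ge> 1" "r \<ge> 1" "\<alpha> + \<beta> = \<alpha>' + \<beta>'"
  shows "(\<Sum>\<sigma>\<in>colored_sign_class d r s e. word_wt t \<alpha> \<beta> 0 (code_word d \<sigma>) 0) =
    (\<Sum>\<sigma>\<in>colored_sign_class d r s e. word_wt t \<alpha>' \<beta>' 0 (code_word d \<sigma>) 0)"
proof -
  let ?SS = "(\<lambda>\<sigma>. set (code_word d \<sigma>)) ` colored_perms d r"
  have inj: "inj_on (code_word d) (colored_sign_class d r s e)"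
    by (rule inj_on_subset[OF inj_on_code_word[OF assms(2)]]) (auto simp: colored_sign_class_def)
  have sum: "(\<Sum>\<sigma>\<in>colored_sign_class d r s e. f (code_word d \<sigma>)) =
      (\<Sum>S\<in>?SS. \<Sum>w\<in>signed_perms s e S. f w)" for f :: "int list \<Rightarrow> 'a"
  proof -
    have "(\<Sum>\<sigma>\<in>colored_sign_class d r s e. f (code_word d \<sigma>)) =
        (\<Sum>w\<in>(\<Union>S\<in>?SS. signed_perms s e S). f w)"
      unfolding code_word_image_sign_class[OF assms(1,2), symmetric] by (simp add: sum.reindex[OF inj])
    also have "\<dots> = (\<Sum>S\<in>?SS. \<Sum>w\<in>signed_perms s e S. f w)"
      by (rule sum.UNION_disjoint)
        (auto simp: finite_colored_perms finite_signed_perms, auto simp: signed_perms_def permutations_of_set_def)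
    finally show ?thesis .
  qed
  show ?thesis
    unfolding sum[of "\<lambda>w. word_wt t \<alpha> \<beta> 0 w 0"] sum[of "\<lambda>w. word_wt t \<alpha>' \<beta>' 0 w 0"]
    using zero_notin_code_word[OF _ assms(2)]
    by (intro sum.cong refl sum_signed_perms_word_wt_eq assms(3)) auto
qed

section \<open>Descents, slides and ascents\<close>

definition ascent :: "nat \<Rightarrow> (nat \<times> nat \<Rightarrow> nat \<times> nat) \<Rightarrow> nat \<Rightarrow> bool" where
  "ascent d \<sigma> i \<longleftrightarrow>
     (0 # code_word d \<sigma> @ [0]) ! i < (0 # code_word d \<sigma> @ [0]) ! Suc i"

lemma word_wt_code_word:
  "word_wt t \<alpha> \<beta> 0 (code_word d \<sigma>) 0 =
     (\<Prod>i<d. letter_wt t \<alpha> \<beta> (ascent d \<sigma> i) (ascent d \<sigma> (Suc i)))"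
  unfolding word_wt_conv_prod ascent_def by simp

text \<open>\<open>code\<close> preserves the order of coloured letters, and \<open>0\<close> has
  the same place among them as either end entry. Neighbouring entries never tie, so the absence of
  an ascent is a descent, also at position \<open>0\<close>.\<close>

lemma ascent_iff:
  assumes "\<sigma> \<in> colored_perms d r" "r \<ge> 1" "d \<ge> 1" "i \<le> d"
  shows "ascent d \<sigma> i \<longleftrightarrow> win_col d \<sigma> i < win_col d \<sigma> (i + 1) \<or>
      win_col d \<sigma> i = win_col d \<sigma> (i + 1) \<and> win_val d \<sigma> i < win_val d \<sigma> (i + 1)"
    and "\<not> ascent d \<sigma> i \<longleftrightarrow> win_col d \<sigma> i > win_col d \<sigma> (i + 1) \<or>
      win_col d \<sigma> i = win_col d \<sigma> (i + 1) \<and> win_val d \<sigma> i > win_val d \<sigma> (i + 1)"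
proof -
  have in_range: "\<sigma> (j, 0) \<in> {1..d} \<times> {0..<r}" if "j \<in> {1..d}" for j
    using colored_perms_in[OF assms(1) that, of 0] assms(2) by simp
  have entry: "(0 # code_word d \<sigma> @ [0]) ! j =
      (if j = 0 \<or> j = d + 1 then 0 else code d (\<sigma> (j, 0)))" if "j \<le> d + 1" for j
    using that by (cases j) (auto simp: nth_append code_word_nth)
  have asc: "ascent d \<sigma> i \<longleftrightarrow> (if i = 0 then 0 < code d (\<sigma> (1, 0)) else
      if i = d then code d (\<sigma> (d, 0)) < 0 else code d (\<sigma> (i, 0)) < code d (\<sigma> (Suc i, 0)))"
    using entry[of i] entry[of "Suc i"] assms(3,4) unfolding ascent_def
    by (simp del: nth_Cons_Suc)
  let ?P = "win_col d \<sigma> i < win_col d \<sigma> (i + 1) \<or>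
      win_col d \<sigma> i = win_col d \<sigma> (i + 1) \<and> win_val d \<sigma> i < win_val d \<sigma> (i + 1)"
  let ?Q = "win_col d \<sigma> i > win_col d \<sigma> (i + 1) \<or>
      win_col d \<sigma> i = win_col d \<sigma> (i + 1) \<and> win_val d \<sigma> i > win_val d \<sigma> (i + 1)"
  have "(ascent d \<sigma> i \<longleftrightarrow> ?P) \<and> (\<not> ascent d \<sigma> i \<longleftrightarrow> ?Q)"
  proof -
    consider "i = 0" | "i = d" | "0 < i" "i < d" using assms(4) by linarith
    then show ?thesis
    proof cases
      case 1
      have "\<sigma> (1, 0) \<in> {1..d} \<times> {0..<r}" using in_range assms(3) by simp
      with 1 show ?thesis
        using asc code_neg_iff[of "\<sigma> (1, 0)" d r] code_nonzero[of "\<sigma> (1, 0)" d r] assms(3)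
        by (auto simp: win_col_def win_val_def)
    next
      case 2
      have "\<sigma> (d, 0) \<in> {1..d} \<times> {0..<r}" using in_range assms(3) by simp
      with 2 show ?thesis
        using asc code_neg_iff[of "\<sigma> (d, 0)" d r] assms(3)
        by (auto simp: win_col_def win_val_def mem_Times_iff)
    next
      case 3
      have m: "\<sigma> (i, 0) \<in> {1..d} \<times> {0..<r}" "\<sigma> (Suc i, 0) \<in> {1..d} \<times> {0..<r}"
        using in_range 3 by simp_all
      have "inj \<sigma>" using assms(1) by (auto simp: colored_perms_def permutes_inj)
      then have "\<sigma> (i, 0) \<noteq> \<sigma> (Suc i, 0)" by (simp add: inj_eq)
      then show ?thesis
        using 3 code_less_iff[OF m] by (auto simp: asc win_col_def win_val_def prod_eq_iff)
    qed
  qed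
  then show "ascent d \<sigma> i \<longleftrightarrow> ?P" "\<not> ascent d \<sigma> i \<longleftrightarrow> ?Q" by blast+
qed

lemma Des_conv_ascent:
  assumes "\<sigma> \<in> colored_perms d r" "r \<ge> 1" "d \<ge> 1"
  shows "Des d \<sigma> = {i \<in> {1..d}. \<not> ascent d \<sigma> i}"
  using ascent_iff(2)[OF assms] by (auto simp: Des_def)

lemma asterisks_conv_ascent:
  assumes "\<sigma> \<in> colored_perms d r" "r \<ge> 1" "d \<ge> 1"
  shows "asterisks d \<sigma> = {0, d + 2} \<union> {Suc i | i. i \<le> d \<and> ascent d \<sigma> i}"
  using ascent_iff(1)[OF assms] by (auto simp: asterisks_def)

text \<open>A slide is determined by its first entry \<open>i\<close>: there is an asterisk in front
  of \<open>i\<close> but none in front of \<open>i + 1\<close>.\<close>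

lemma card_slides:
  assumes "\<sigma> \<in> colored_perms d r" "r \<ge> 1" "d \<ge> 1"
  shows "card (slides d \<sigma>) = card {i \<in> {..d}. \<not> ascent d \<sigma> i \<and> (i = 0 \<or> ascent d \<sigma> (i - 1))}"
proof -
  let ?A = "asterisks d \<sigma>" and ?I = "{i \<in> {..d}. \<not> ascent d \<sigma> i \<and> (i = 0 \<or> ascent d \<sigma> (i - 1))}"
  note A = asterisks_conv_ascent[OF assms]
  have "inj_on fst (slides d \<sigma>)"
  proof (rule inj_onI)
    fix x y assume xy: "x \<in> slides d \<sigma>" "y \<in> slides d \<sigma>" "fst x = fst y"
    have "\<not> b < c" if "(a, b) \<in> slides d \<sigma>" "(a, c) \<in> slides d \<sigma>" for a b c
      using that by (auto simp: slides_def)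
    from this[of "fst x" "snd x" "snd y"] this[of "fst x" "snd y" "snd x"] xy show "x = y"
      by (cases x; cases y) auto
  qed
  moreover have "fst ` slides d \<sigma> = ?I"
  proof (intro equalityI subsetI)
    fix a assume "a \<in> fst ` slides d \<sigma>"
    then obtain b where b: "a \<in> ?A" "b \<in> ?A" "a + 2 \<le> b" "\<forall>k. a < k \<and> k < b \<longrightarrow> k \<notin> ?A"
      by (auto simp: slides_def)
    have "b \<le> d + 2" using b(2) by (auto simp: A)
    with b have "a \<le> d" by linarith
    moreover have "Suc a \<notin> ?A" using b(3,4) by auto
    ultimately show "a \<in> ?I" using b(1) by (auto simp: A)
  next
    fix a assume a: "a \<in> ?I"
    then have aA: "a \<in> ?A" "Suc a \<notin> ?A" "a \<le> d"
      by (cases a; auto simp: A)+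
    \<comment> \<open>The right end of the slide is the next asterisk after \<open>a\<close>; one
      exists because gap \<open>d + 2\<close> always carries one.\<close>
    define b where "b = (LEAST k. k \<in> ?A \<and> a < k)"
    have b: "b \<in> ?A \<and> a < b" unfolding b_def by (rule LeastI[of _ "d + 2"]) (use aA in \<open>auto simp: A\<close>)
    have least: "k \<notin> ?A" if "a < k" "k < b" for k
      using not_less_Least[of k "\<lambda>k. k \<in> ?A \<and> a < k"] that by (auto simp: b_def)
    have "b \<noteq> Suc a" using b aA by auto
    with b have "a + 2 \<le> b" by linarith
    with aA b least have "(a, b) \<in> slides d \<sigma>" by (auto simp: slides_def)
    then show "a \<in> fst ` slides d \<sigma>" by force
  qed
  ultimately show ?thesis by (metis card_image)
qed

text \<open>The non-ascents among \<open>0, ..., d\<close> are the descents together with position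
  \<open>0\<close>, which \<open>Des\<close> leaves out. Slides count maximal runs of non-ascents,
  so equality means that every run has length one: no double descent.\<close>

lemma card_slides_eq_iff:
  assumes "\<sigma> \<in> colored_perms d r" "r \<ge> 1" "d \<ge> 1" "\<not> ascent d \<sigma> 0"
  shows "card (slides d \<sigma>) = des d \<sigma> + 1 \<longleftrightarrow> (\<forall>i<d. ascent d \<sigma> i \<or> ascent d \<sigma> (Suc i))"
proof -
  let ?G = "{i \<in> {..d}. \<not> ascent d \<sigma> i}"
  let ?I = "{i \<in> {..d}. \<not> ascent d \<sigma> i \<and> (i = 0 \<or> ascent d \<sigma> (i - 1))}"
  have "?G = insert 0 (Des d \<sigma>)" using assms(4) by (auto simp: Des_conv_ascent[OF assms(1-3)])
  moreover have "0 \<notin> Des d \<sigma>" "finite (Des d \<sigma>)" by (auto simp: Des_def)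
  ultimately have "card ?G = des d \<sigma> + 1" by (simp add: des_def)
  then have "card (slides d \<sigma>) = des d \<sigma> + 1 \<longleftrightarrow> card ?I = card ?G"
    using card_slides[OF assms(1-3)] by simp
  also have "\<dots> \<longleftrightarrow> ?I = ?G"
  proof
    have "finite ?G" "?I \<subseteq> ?G" by auto
    then show "card ?I = card ?G \<Longrightarrow> ?I = ?G" by (rule card_subset_eq)
  qed (rule arg_cong)
  also have "\<dots> \<longleftrightarrow> (\<forall>i<d. ascent d \<sigma> i \<or> ascent d \<sigma> (Suc i))"
  proof
    assume eq: "?I = ?G"
    show "\<forall>i<d. ascent d \<sigma> i \<or> ascent d \<sigma> (Suc i)"
    proof (intro allI impI)
      fix i assume "i < d"
      then show "ascent d \<sigma> i \<or> ascent d \<sigma> (Suc i)"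
        using eqset_imp_iff[OF eq, of "Suc i"] by auto
    qed
  next
    assume *: "\<forall>i<d. ascent d \<sigma> i \<or> ascent d \<sigma> (Suc i)"
    have "ascent d \<sigma> (i - 1)" if "i \<le> d" "\<not> ascent d \<sigma> i" "i \<noteq> 0" for i
      using *[rule_format, of "i - 1"] that by auto
    then show "?I = ?G" by auto
  qed
  finally show ?thesis .
qed

text \<open>With \<open>\<alpha> = t\<close> and \<open>\<beta> = 1\<close> a letter weighs
  \<open>t\<close> exactly when it is left by a descent, however it is entered. The
  \<open>i\<close>-th factor is left at \<open>Suc i\<close>, hence the range from \<open>1\<close>
  to \<open>n\<close>.\<close>

lemma prod_letter_wt_descents:
  "(\<Prod>i<n. letter_wt t t 1 (asc i) (asc (Suc i))) = t ^ card {i \<in> {1..n}. \<not> asc i}"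
proof (induction n)
  case (Suc n)
  have "{i \<in> {1..Suc n}. \<not> asc i} =
      {i \<in> {1..n}. \<not> asc i} \<union> (if asc (Suc n) then {} else {Suc n})"
    by (auto simp: le_Suc_eq)
  then have "card {i \<in> {1..Suc n}. \<not> asc i} =
      card {i \<in> {1..n}. \<not> asc i} + (if asc (Suc n) then 0 else 1)" by simp
  with Suc show ?case by (simp add: letter_wt_def)
qed simp

text \<open>Without double descents the letters are peaks, valleys and double ascents; the descents are the
  peaks, and peaks and valleys alternate.\<close>

lemma prod_letter_wt_no_double_descent:
  assumes "\<forall>i<n. asc i \<or> asc (Suc i)"
  shows "\<exists>k. (\<Prod>i<n. letter_wt t 0 \<beta> (asc i) (asc (Suc i))) =
      t ^ card {i \<in> {1..n}. \<not> asc i} * \<beta> ^ k \<and>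
    k + 2 * card {i \<in> {1..n}. \<not> asc i} + of_bool (\<not> asc 0) = n + of_bool (\<not> asc n)"
  using assms
proof (induction n)
  case (Suc n)
  then obtain k where k: "(\<Prod>i<n. letter_wt t 0 \<beta> (asc i) (asc (Suc i))) =
      t ^ card {i \<in> {1..n}. \<not> asc i} * \<beta> ^ k"
    "k + 2 * card {i \<in> {1..n}. \<not> asc i} + of_bool (\<not> asc 0) = n + of_bool (\<not> asc n)"
    by auto
  have "{i \<in> {1..Suc n}. \<not> asc i} =
      {i \<in> {1..n}. \<not> asc i} \<union> (if asc (Suc n) then {} else {Suc n})"
    by (auto simp: le_Suc_eq)
  then have card: "card {i \<in> {1..Suc n}. \<not> asc i} =
      card {i \<in> {1..n}. \<not> asc i} + (if asc (Suc n) then 0 else 1)" by simp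
  have "asc n \<or> asc (Suc n)" using Suc.prems by simp
  \<comment> \<open>\<open>k\<close> counts the double ascents, so it grows only if the new letter
    is entered and left by ascents. A new peak adds \<open>2\<close> on the left, balanced by
    \<open>n\<close> and the end term; a valley leaves the left side alone and removes the end
    term.\<close>
  then show ?case
    using k unfolding card
    by (intro exI[of _ "if asc n \<and> asc (Suc n) then Suc k else k"]) (auto simp: letter_wt_def mult_ac)
qed simp

lemma prod_letter_wt_double_descent:
  assumes "i < n" "\<not> asc i" "\<not> asc (Suc i)"
  shows "(\<Prod>i<n. letter_wt t 0 \<beta> (asc i) (asc (Suc i))) = 0"
  using assms by (intro prod_zero) (auto simp: letter_wt_def)

lemma sign_class_ascent:
  assumes "d \<ge> 1" "r \<ge> 1" "\<sigma> \<in> colored_sign_class d r True e"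
  shows "\<not> ascent d \<sigma> 0" "ascent d \<sigma> d \<longleftrightarrow> e"
proof -
  have ne: "code_word d \<sigma> \<noteq> []" using assms(1) by (metis length_code_word list.size(3) not_one_le_zero)
  have \<sigma>: "\<sigma> \<in> colored_perms d r" "hd (code_word d \<sigma>) < 0" "(last (code_word d \<sigma>) < 0) = e"
    using assms(3) by (auto simp: colored_sign_class_def)
  show "\<not> ascent d \<sigma> 0" using \<sigma>(2) ne by (cases "code_word d \<sigma>") (auto simp: ascent_def)
  have "(0 # code_word d \<sigma> @ [0]) ! d = last (code_word d \<sigma>)"
    using ne assms(1) by (cases d) (auto simp: nth_append last_conv_nth)
  then show "ascent d \<sigma> d \<longleftrightarrow> e"
    using \<sigma>(3) by (simp add: ascent_def nth_append)
qed

section \<open>Gamma-expansion and symmetry\<close>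

definition gamma_count :: "nat \<Rightarrow> (nat \<times> nat \<Rightarrow> nat \<times> nat) set \<Rightarrow> nat \<Rightarrow> nat" where
  "gamma_count d A i = card {\<sigma> \<in> A. des d \<sigma> = i \<and> card (slides d \<sigma>) = i + 1}"

text \<open>The total weight is the same at \<open>(t, 1)\<close> and at \<open>(0, 1 + t)\<close>.
  The first choice gives the descent polynomial; the second leaves \<open>t^des * (1 + t)^k\<close>
  for words without double descents. A final ascent costs one factor \<open>1 + t\<close>, hence
  \<open>of_bool e\<close>.\<close>

lemma sign_class_gamma_sum:
  assumes "d \<ge> 1" "r \<ge> 1"
  shows "(\<Sum>\<sigma>\<in>colored_sign_class d r True e. monom 1 (des d \<sigma>) :: real poly) =
    gamma_sum (d - of_bool e) (\<lambda>i. real (gamma_count d (colored_sign_class d r True e) i))"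
proof -
  let ?C = "colored_sign_class d r True e" and ?t = "monom 1 1 :: real poly"
  let ?n = "d - of_bool e" and ?q = "\<lambda>i. monom 1 i * [:1, 1:] ^ (d - of_bool e - 2 * i) :: real poly"
  let ?B = "{\<sigma> \<in> ?C. card (slides d \<sigma>) = des d \<sigma> + 1}"
  have fin: "finite ?C" using finite_colored_perms by (simp add: colored_sign_class_def)
  have cp: "\<sigma> \<in> colored_perms d r" if "\<sigma> \<in> ?C" for \<sigma> using that by (simp add: colored_sign_class_def)
  have des: "des d \<sigma> = card {i \<in> {1..d}. \<not> ascent d \<sigma> i}" if "\<sigma> \<in> ?C" for \<sigma>
    using Des_conv_ascent[OF cp[OF that] assms(2,1)] by (simp add: des_def)
  have t_power: "?t ^ k = monom 1 k" for k by (simp add: monom_power)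
  \<comment> \<open>The word starts with a descent and ends with an ascent exactly if
    \<open>e\<close> holds; these boundary values determine the exponent \<open>k\<close> from the
    number of descents.\<close>
  have factor: thesis if "\<sigma> \<in> ?B" and "\<And>k. word_wt ?t 0 [:1, 1:] 0 (code_word d \<sigma>) 0 =
      ?t ^ des d \<sigma> * [:1, 1:] ^ k \<Longrightarrow> k + 2 * des d \<sigma> + 1 = d + of_bool (\<not> e) \<Longrightarrow> thesis"
    for \<sigma> thesis
  proof -
    have C: "\<sigma> \<in> ?C" using that(1) by simp
    have "\<forall>i<d. ascent d \<sigma> i \<or> ascent d \<sigma> (Suc i)"
      using that(1) card_slides_eq_iff[OF cp[OF C] assms(2,1) sign_class_ascent(1)[OF assms C]] by simp
    from prod_letter_wt_no_double_descent[OF this, of ?t "[:1, 1:]"] show thesis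
      using that(2) sign_class_ascent[OF assms C] unfolding word_wt_code_word des[OF C] by force
  qed
  have "word_wt ?t ?t 1 0 (code_word d \<sigma>) 0 = monom 1 (des d \<sigma>)" if "\<sigma> \<in> ?C" for \<sigma>
    unfolding word_wt_code_word prod_letter_wt_descents t_power by (simp add: des[OF that])
  then have "(\<Sum>\<sigma>\<in>?C. monom 1 (des d \<sigma>)) = (\<Sum>\<sigma>\<in>?C. word_wt ?t ?t 1 0 (code_word d \<sigma>) 0)"
    by simp
  also have "\<dots> = (\<Sum>\<sigma>\<in>?C. word_wt ?t 0 [:1, 1:] 0 (code_word d \<sigma>) 0)"
    by (rule sum_sign_class_word_wt_eq[OF assms]) (simp add: monom_altdef one_pCons)
  also have "\<dots> = (\<Sum>\<sigma>\<in>?B. ?q (des d \<sigma>))"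
  proof (rule sum.mono_neutral_cong_right[OF fin])
    show "\<forall>\<sigma>\<in>?C - ?B. word_wt ?t 0 [:1, 1:] 0 (code_word d \<sigma>) 0 = 0"
    proof
      fix \<sigma> assume \<sigma>: "\<sigma> \<in> ?C - ?B"
      then obtain i where "i < d" "\<not> ascent d \<sigma> i" "\<not> ascent d \<sigma> (Suc i)"
        using card_slides_eq_iff[OF cp assms(2,1) sign_class_ascent(1)[OF assms]] by blast
      then show "word_wt ?t 0 [:1, 1:] 0 (code_word d \<sigma>) 0 = 0"
        unfolding word_wt_code_word by (rule prod_letter_wt_double_descent)
    qed
    fix \<sigma> assume \<sigma>: "\<sigma> \<in> ?B"
    from \<sigma> obtain k where k: "word_wt ?t 0 [:1, 1:] 0 (code_word d \<sigma>) 0 = ?t ^ des d \<sigma> * [:1, 1:] ^ k"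
        "k + 2 * des d \<sigma> + 1 = d + of_bool (\<not> e)" by (rule factor)
    have "k = ?n - 2 * des d \<sigma>" using k(2) assms(1) by (cases e) auto
    then show "word_wt ?t 0 [:1, 1:] 0 (code_word d \<sigma>) 0 = ?q (des d \<sigma>)"
      using k(1) unfolding t_power by simp
  qed auto
  also have "\<dots> = (\<Sum>i = 0..?n div 2. \<Sum>\<sigma>\<in>{\<sigma> \<in> ?B. des d \<sigma> = i}. ?q (des d \<sigma>))"
  proof (rule sum.group[symmetric])
    \<comment> \<open>The exponent \<open>k\<close> is a natural number, which bounds the number of
      descents by half of \<open>?n\<close>.\<close>
    show "des d ` ?B \<subseteq> {0..?n div 2}"
    proof (rule image_subsetI)
      fix \<sigma> assume "\<sigma> \<in> ?B"
      then obtain k where "k + 2 * des d \<sigma> + 1 = d + of_bool (\<not> e)" by (rule factor)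
      then show "des d \<sigma> \<in> {0..?n div 2}" by (cases e) auto
    qed
  qed (use fin in auto)
  also have "\<dots> = gamma_sum ?n (\<lambda>i. real (gamma_count d ?C i))"
    unfolding gamma_sum_def
  proof (rule sum.cong[OF refl])
    fix i
    have "{\<sigma> \<in> ?B. des d \<sigma> = i} = {\<sigma> \<in> ?C. des d \<sigma> = i \<and> card (slides d \<sigma>) = i + 1}" by auto
    then have "(\<Sum>\<sigma>\<in>{\<sigma> \<in> ?B. des d \<sigma> = i}. ?q (des d \<sigma>)) = of_nat (gamma_count d ?C i) * ?q i"
      by (simp add: gamma_count_def)
    then show "(\<Sum>\<sigma>\<in>{\<sigma> \<in> ?B. des d \<sigma> = i}. ?q (des d \<sigma>)) = smult (real (gamma_count d ?C i)) (?q i)"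
      by (simp add: of_nat_poly)
  qed
  finally show ?thesis .
qed

text \<open>Each summand is palindromic about \<open>n / 2\<close>, by the symmetry of the binomial
  coefficients.\<close>

lemma symmetric_poly_gamma_sum: "symmetric_poly n (gamma_sum n \<gamma>)"
proof -
  let ?q = "\<lambda>i. monom 1 i * [:1, 1:] ^ (n - 2 * i) :: real poly"
  have q: "coeff (?q i) k = (if i \<le> k then of_nat ((n - 2 * i) choose (k - i)) else 0)" for i k
  proof (cases "i \<le> k \<and> k - i \<le> n - 2 * i")
    case True
    then show ?thesis by (simp add: coeff_monom_mult coeff_linear_poly_power)
  next
    case False
    have "degree ([:1, 1:] ^ (n - 2 * i) :: real poly) = n - 2 * i"
      by (simp add: degree_power_eq)
    with False show ?thesis by (auto simp: coeff_monom_mult binomial_eq_0 coeff_eq_0)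
  qed
  \<comment> \<open>The range \<open>i \<le> k \<le> n - i\<close> is invariant under
    \<open>k\<close> to \<open>n - k\<close>; outside it both coefficients vanish.\<close>
  have sym: "coeff (?q i) k = coeff (?q i) (n - k)" if "k \<le> n" "i \<le> n div 2" for i k
  proof (cases "i \<le> k \<and> k \<le> n - i")
    case True
    then have "(n - 2 * i) choose (k - i) = (n - 2 * i) choose (n - k - i)"
      by (subst binomial_symmetric) (auto intro: arg_cong2[of _ _ _ _ binomial])
    then show ?thesis using True that unfolding q by auto
  next
    case False
    then have "coeff (?q i) k = 0" using that unfolding q by (auto simp: binomial_eq_0)
    moreover have "coeff (?q i) (n - k) = 0" using False that unfolding q by (auto simp: binomial_eq_0)
    ultimately show ?thesis by simp
  qed
  have "degree (?q i) \<le> n" if "i \<le> n div 2" for i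
    using degree_mult_le[of "monom 1 i :: real poly" "[:1, 1:] ^ (n - 2 * i)"] that
    by (simp add: degree_monom_eq degree_power_eq)
  then have "degree (gamma_sum n \<gamma>) \<le> n"
    unfolding gamma_sum_def by (intro degree_sum_le) (auto intro: order_trans[OF degree_smult_le])
  moreover have "coeff (gamma_sum n \<gamma>) k = coeff (gamma_sum n \<gamma>) (n - k)" if "k \<le> n" for k
    unfolding gamma_sum_def coeff_sum coeff_smult using sym[OF that] by (intro sum.cong) auto
  ultimately show ?thesis unfolding symmetric_poly_def by blast
qed

lemma gamma_nonnegative_gamma_sum:
  "(\<And>i. \<gamma> i \<ge> 0) \<Longrightarrow> gamma_nonnegative n (gamma_sum n \<gamma>)"
  unfolding gamma_nonnegative_def using symmetric_poly_gamma_sum by blast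

lemma symmetric_polyD:
  assumes "symmetric_poly n p"
  shows "degree p \<le> n" "i \<le> n \<Longrightarrow> coeff p (n - i) = coeff p i"
  using assms unfolding symmetric_poly_def by metis+

section \<open>The two polynomials and their degrees\<close>

lemma colored_sign_class_eq:
  assumes "d \<ge> 1" "r \<ge> 1"
  shows "colored_sign_class d r True True = A_col d r 0"
    and "colored_sign_class d r True False = A_neq d r"
proof -
  have "(hd (code_word d \<sigma>) < 0) = (win_col d \<sigma> 1 = 0)"
    "(last (code_word d \<sigma>) < 0) = (win_col d \<sigma> d = 0)" if "\<sigma> \<in> colored_perms d r" for \<sigma>
  proof -
    have "code_word d \<sigma> \<noteq> []" using assms(1) by (metis length_code_word list.size(3) not_one_le_zero)
    then have "hd (code_word d \<sigma>) = code d (\<sigma> (1, 0))" "last (code_word d \<sigma>) = code d (\<sigma> (d, 0))"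
      using assms(1) by (simp_all add: hd_conv_nth last_conv_nth code_word_nth)
    then show "(hd (code_word d \<sigma>) < 0) = (win_col d \<sigma> 1 = 0)"
      "(last (code_word d \<sigma>) < 0) = (win_col d \<sigma> d = 0)"
      using code_neg_iff[OF colored_perms_in[OF that, of 1 0]]
        code_neg_iff[OF colored_perms_in[OF that, of d 0]] assms
      by (auto simp: win_col_def)
  qed
  then show "colored_sign_class d r True True = A_col d r 0"
    "colored_sign_class d r True False = A_neq d r"
    by (auto simp: colored_sign_class_def A_col_def A_neq_def A_set_def)
qed

lemma A_neq_poly_eq:
  assumes "d \<ge> 1" "r \<ge> 1"
  shows "A_neq_poly d r = (\<Sum>\<sigma>\<in>A_neq d r. monom 1 (des d \<sigma>))"
proof -
  have "(\<Sum>\<sigma>\<in>A_neq d r. monom 1 (des d \<sigma>) :: real poly) =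
      (\<Sum>s = 1..r - 1. \<Sum>\<sigma>\<in>{\<sigma> \<in> A_neq d r. win_col d \<sigma> d = s}. monom 1 (des d \<sigma>))"
  proof (rule sum.group[symmetric])
    show "finite (A_neq d r)" using finite_colored_perms by (simp add: A_neq_def A_set_def)
    have "win_col d \<sigma> d < r" if "\<sigma> \<in> colored_perms d r" for \<sigma>
      using colored_perms_in[OF that, of d 0] assms by (auto simp: win_col_def mem_Times_iff)
    then show "(\<lambda>\<sigma>. win_col d \<sigma> d) ` A_neq d r \<subseteq> {1..r - 1}"
      by (fastforce simp: A_neq_def A_set_def)
  qed simp
  also have "\<dots> = A_neq_poly d r"
    unfolding A_neq_poly_def A_col_poly_def
    by (intro sum.cong) (auto simp: A_neq_def A_col_def)
  finally show ?thesis ..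
qed

text \<open>Nothing cancels in a sum of monomials with coefficient \<open>1\<close>, so one
  permutation with \<open>k\<close> descents suffices. This gives the lower bounds for the
  degrees.\<close>

lemma coeff_sum_monom_pos:
  assumes "finite A" "x \<in> A" "f x = k"
  shows "coeff (\<Sum>x\<in>A. monom 1 (f x) :: real poly) k > 0"
  unfolding coeff_sum using assms by (intro sum_pos2[of A x]) auto

lemma id_colored_perms: "id \<in> colored_perms d r"
  by (auto simp: colored_perms_def permutes_id)

lemma des_id: "d \<ge> 1 \<Longrightarrow> des d id = 0"
  by (auto simp: des_def Des_def win_col_def win_val_def)

text \<open>For \<open>r \<ge> 2\<close> its word is that of the identity with the last letter in
  colour \<open>1\<close>. It witnesses that \<open>A_neq\<close> contains a permutation with a
  single descent when also \<open>d \<ge> 2\<close>.\<close>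

definition last_recolored :: "nat \<Rightarrow> nat \<Rightarrow> nat \<times> nat \<Rightarrow> nat \<times> nat" where
  "last_recolored d r x = (if fst x = d \<and> snd x < r then (d, (snd x + 1) mod r) else x)"

lemma last_recolored_colored_perms:
  assumes "d \<ge> 1" "r \<ge> 2"
  shows "last_recolored d r \<in> colored_perms d r"
proof -
  let ?A = "{1..d} \<times> {0..<r}"
  have "last_recolored d r ` ?A \<subseteq> ?A" using assms by (auto simp: last_recolored_def)
  moreover have "inj_on (last_recolored d r) ?A"
  proof (rule inj_onI)
    fix x y assume xy: "x \<in> ?A" "y \<in> ?A" "last_recolored d r x = last_recolored d r y"
    then have fst: "fst x = fst y"
      by (auto simp: last_recolored_def mem_Times_iff prod_eq_iff split: if_splits)
    show "x = y"
    proof (cases "fst x = d")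
      case True
      with xy fst have "Suc (snd x) mod r = Suc (snd y) mod r" "snd x < r" "snd y < r"
        by (auto simp: last_recolored_def mem_Times_iff)
      then have "snd x = snd y" by (auto simp: mod_Suc split: if_splits)
      with fst show ?thesis by (simp add: prod_eq_iff)
    next
      case False
      with xy fst show ?thesis by (simp add: last_recolored_def)
    qed
  qed
  ultimately have "bij_betw (last_recolored d r) ?A ?A" by (simp add: bij_betw_def endo_inj_surj)
  then have "last_recolored d r permutes ?A"
    by (rule bij_imp_permutes) (use assms in \<open>auto simp: last_recolored_def\<close>)
  then show ?thesis using assms by (auto simp: colored_perms_def last_recolored_def)
qed

lemma des_last_recolored:
  assumes "d \<ge> 2" "r \<ge> 2"
  shows "des d (last_recolored d r) = 1"
proof -
  have "Des d (last_recolored d r) = {d}"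
    using assms by (auto simp: Des_def win_col_def win_val_def last_recolored_def split: if_splits)
  then show ?thesis by (simp add: des_def)
qed

text \<open>A last letter of nonzero colour exceeds the end entry of colour \<open>0\<close>, so
  \<open>d\<close> is a descent.\<close>

lemma des_pos_A_neq: "d \<ge> 1 \<Longrightarrow> \<sigma> \<in> A_neq d r \<Longrightarrow> des d \<sigma> > 0"
proof -
  assume "d \<ge> 1" "\<sigma> \<in> A_neq d r"
  then have "d \<in> Des d \<sigma>" by (auto simp: Des_def A_neq_def win_col_def)
  moreover have "finite (Des d \<sigma>)" by (simp add: Des_def)
  ultimately show ?thesis by (auto simp: des_def card_gt_0_iff)
qed

text \<open>The second polynomial is palindromic about \<open>d / 2\<close> but has no constant
  term, so its degree is \<open>d - 1\<close> whenever \<open>d\<close> and \<open>r\<close> are at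
  least \<open>2\<close>. For even \<open>d\<close> and \<open>r \<ge> 2\<close> the index
  \<open>d div 2\<close> does occur, on words alternating between colours \<open>0\<close> and
  \<open>1\<close>.\<close>

theorem theorem3p4:
  fixes d r :: nat
  assumes "d \<ge> 1" and "r \<ge> 1"
  shows "symmetric_poly (d - 1) (A_col_poly d r 0) \<and> degree (A_col_poly d r 0) = d - 1 \<and>
    symmetric_poly d (A_neq_poly d r) \<and>
    (d \<ge> 2 \<and> r \<ge> 2 \<longrightarrow> degree (A_neq_poly d r) = d - 1) \<and>
    A_col_poly d r 0 =
      (\<Sum>i = 0..(d - 1) div 2.
         smult (real (a_zero d r i)) (monom 1 i * [:1, 1:] ^ (d - 1 - 2 * i))) \<and>
    A_neq_poly d r =
      (\<Sum>i = 0..d div 2.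
         smult (real (a_neq d r i)) (monom 1 i * [:1, 1:] ^ (d - 2 * i))) \<and>
    gamma_nonnegative (d - 1) (A_col_poly d r 0) \<and>
    gamma_nonnegative d (A_neq_poly d r)"
proof -
  have zero: "A_col_poly d r 0 = gamma_sum (d - 1) (\<lambda>i. real (a_zero d r i))"
    using sign_class_gamma_sum[OF assms, of True]
    by (simp add: colored_sign_class_eq[OF assms] A_col_poly_def gamma_count_def a_zero_def)
  have neq: "A_neq_poly d r = gamma_sum d (\<lambda>i. real (a_neq d r i))"
    using sign_class_gamma_sum[OF assms, of False]
    by (simp add: colored_sign_class_eq[OF assms] A_neq_poly_eq[OF assms] gamma_count_def a_neq_def)
  have sym0: "symmetric_poly (d - 1) (A_col_poly d r 0)"
    unfolding zero by (rule symmetric_poly_gamma_sum)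
  have symn: "symmetric_poly d (A_neq_poly d r)"
    unfolding neq by (rule symmetric_poly_gamma_sum)
  have "id \<in> A_col d r 0"
    using assms id_colored_perms by (auto simp: A_col_def A_set_def win_col_def)
  \<comment> \<open>The identity has no descents; symmetry moves the positive constant coefficient
    to index \<open>d - 1\<close>.\<close>
  then have "coeff (A_col_poly d r 0) 0 > 0"
    unfolding A_col_poly_def using assms finite_colored_perms
    by (intro coeff_sum_monom_pos[of _ id]) (auto simp: des_id A_col_def A_set_def)
  then have "coeff (A_col_poly d r 0) (d - 1) \<noteq> 0"
    using symmetric_polyD(2)[OF sym0, of 0] by simp
  then have deg0: "degree (A_col_poly d r 0) = d - 1"
    by (intro antisym symmetric_polyD(1)[OF sym0] le_degree)
  have degn: "degree (A_neq_poly d r) = d - 1" if "d \<ge> 2" "r \<ge> 2"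
  proof -
    \<comment> \<open>Every member of \<open>A_neq\<close> has a descent; by symmetry the
      coefficient at \<open>d\<close> vanishes as well.\<close>
    have "coeff (A_neq_poly d r) 0 = 0"
      unfolding A_neq_poly_eq[OF assms] coeff_sum
      using des_pos_A_neq[OF assms(1)] by (intro sum.neutral) auto
    then have "coeff (A_neq_poly d r) d = 0" using symmetric_polyD(2)[OF symn, of 0] by simp
    then have "degree (A_neq_poly d r) \<noteq> d"
      using that by (metis degree_0 leading_coeff_0_iff not_numeral_le_zero)
    then have "degree (A_neq_poly d r) \<le> d - 1" using symmetric_polyD(1)[OF symn] by simp
    moreover have "last_recolored d r \<in> A_neq d r"
      using that last_recolored_colored_perms[OF assms(1) that(2)]
      by (auto simp: A_neq_def A_set_def win_col_def last_recolored_def)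
    \<comment> \<open>The single descent of \<open>last_recolored\<close> makes index
      \<open>1\<close> occur, and its mirror image is \<open>d - 1\<close>.\<close>
    then have "coeff (A_neq_poly d r) 1 > 0"
      unfolding A_neq_poly_eq[OF assms] using that finite_colored_perms
      by (intro coeff_sum_monom_pos[of _ "last_recolored d r"])
        (auto simp: des_last_recolored A_neq_def A_set_def)
    then have "coeff (A_neq_poly d r) (d - 1) \<noteq> 0"
      using symmetric_polyD(2)[OF symn, of 1] assms(1) by simp
    then have "d - 1 \<le> degree (A_neq_poly d r)" by (rule le_degree)
    ultimately show ?thesis by simp
  qed
  have "gamma_nonnegative (d - 1) (A_col_poly d r 0)" "gamma_nonnegative d (A_neq_poly d r)"
    unfolding zero neq by (rule gamma_nonnegative_gamma_sum, simp)+
  then show ?thesis using sym0 symn deg0 degn zero neq by (simp add: gamma_sum_def)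
qed

end
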